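(* Let $I$ be a non-trivial admissible ideal on $\mathbb{N}$, let $D\subset\mathbb{R}$, let $f:D\to\mathbb{R}$, and let $x_0\in D$. If $f$ is rough $I^*$-continuous at $x_0$, then $f$ is rough $I$-continuous at $x_0$.
   Context: An ideal on $\mathbb{N}$ is a collection $I$ of subsets of $\mathbb{N}$ such that $A,B\in I$ implies $A\cup B\in I$, and $A\in I$, $B\subset A$ implies $B\in I$. It is non-trivial if $I\ne\emptyset$ and $\mathbb{N}\notin I$, and admissible if $\{n\}\in I$ for every $n\in\mathbb{N}$. The filter associated with $I$ is $F(I)=\{\mathbb{N}\setminus A: A\in I\}$. Let $\{y_n\}_{n\in\mathbb{N}}$ be a real sequence, $y\in\mathbb{R}$ and $r\ge 0$ a real number. The sequence is rough $I$-convergent of roughness degree $r$ to $y$ if $\{n\in\mathbb{N}:|y_n-y|\ge r+\varepsilon\}\in I$ for every $\varepsilon>0$. It is rough $I^*$-convergent of roughness degree $r$ to $y$ if there is a set $M=\{m_1<m_2<\cdots<m_k<\cdots\}\in F(I)$ such that for every $\varepsilon>0$ there is $N\in\mathbb{N}$ with $|y_{m_k}-y|<r+\varepsilon$ for all $k\ge N$. It is $I$-convergent (respectively $I^*$-convergent) to $y$ if it is rough $I$-convergent (respectively rough $I^*$-convergent) of roughness degree $0$ to $y$. A function $f:D\to\mathbb{R}$ is rough $I$-continuous at $x\in D$ if there is a real number $r\ge 0$ such that for every sequence $\{x_n\}\subset D$ that is $I$-convergent to $x$, $\{f(x_n)\}$ is rough $I$-convergent of roughness degree $r$ to $f(x)$.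 It is rough $I^*$-continuous at $x\in D$ if there is a real number $r\ge 0$ such that for every sequence $\{x_n\}\subset D$ that is $I^*$-convergent to $x$, $\{f(x_n)\}$ is rough $I^*$-convergent of roughness degree $r$ to $f(x)$. *)

theory Defs
  imports Complex_Main
begin

definition set_ideal :: "nat set set \<Rightarrow> bool" where
  "set_ideal I \<longleftrightarrow>
     (\<forall>A\<in>I. \<forall>B\<in>I. A \<union> B \<in> I) \<and> (\<forall>A\<in>I. \<forall>B. B \<subseteq> A \<longrightarrow> B \<in> I)"

definition nontrivial_ideal :: "nat set set \<Rightarrow> bool" where
  "nontrivial_ideal I \<longleftrightarrow> set_ideal I \<and> I \<noteq> {} \<and> UNIV \<notin> I"

definition admissible_ideal :: "nat set set \<Rightarrow> bool" where
  "admissible_ideal I \<longleftrightarrow> set_ideal I \<and> (\<forall>n. {n} \<in> I)"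

definition assoc_filter :: "nat set set \<Rightarrow> nat set set" where
  "assoc_filter I = {UNIV - A | A. A \<in> I}"

text \<open>The roughness degree \<open>r\<close> is meant to be non-negative; this is imposed
  where \<open>r\<close> is quantified, in the continuity notions below.\<close>

definition rough_I_convergent :: "nat set set \<Rightarrow> real \<Rightarrow> (nat \<Rightarrow> real) \<Rightarrow> real \<Rightarrow> bool" where
  "rough_I_convergent I r y l \<longleftrightarrow>
     (\<forall>\<epsilon>>0. {n. \<bar>y n - l\<bar> \<ge> r + \<epsilon>} \<in> I)"

text \<open>The strictly increasing \<open>m\<close> is the enumeration of \<open>M = {m 0 < m 1 < \<dots>}\<close>.\<close>

definition rough_I_star_convergent :: "nat set set \<Rightarrow> real \<Rightarrow> (nat \<Rightarrow> real) \<Rightarrow> real \<Rightarrow> bool" where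
  "rough_I_star_convergent I r y l \<longleftrightarrow>
     (\<exists>m :: nat \<Rightarrow> nat. strict_mono m \<and> range m \<in> assoc_filter I \<and>
        (\<forall>\<epsilon>>0. \<exists>N. \<forall>k\<ge>N. \<bar>y (m k) - l\<bar> < r + \<epsilon>))"

definition I_convergent :: "nat set set \<Rightarrow> (nat \<Rightarrow> real) \<Rightarrow> real \<Rightarrow> bool" where
  "I_convergent I y l \<longleftrightarrow> rough_I_convergent I 0 y l"

definition I_star_convergent :: "nat set set \<Rightarrow> (nat \<Rightarrow> real) \<Rightarrow> real \<Rightarrow> bool" where
  "I_star_convergent I y l \<longleftrightarrow> rough_I_star_convergent I 0 y l"

text \<open>A function on \<open>D\<close> is a total function of which only the values on \<open>D\<close> are used.\<close>

definition rough_I_continuous_at ::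
    "nat set set \<Rightarrow> real set \<Rightarrow> (real \<Rightarrow> real) \<Rightarrow> real \<Rightarrow> bool" where
  "rough_I_continuous_at I D f x \<longleftrightarrow>
     (\<exists>r\<ge>0. \<forall>s :: nat \<Rightarrow> real. (\<forall>n. s n \<in> D) \<and> I_convergent I s x \<longrightarrow>
        rough_I_convergent I r (\<lambda>n. f (s n)) (f x))"

definition rough_I_star_continuous_at ::
    "nat set set \<Rightarrow> real set \<Rightarrow> (real \<Rightarrow> real) \<Rightarrow> real \<Rightarrow> bool" where
  "rough_I_star_continuous_at I D f x \<longleftrightarrow>
     (\<exists>r\<ge>0. \<forall>s :: nat \<Rightarrow> real. (\<forall>n. s n \<in> D) \<and> I_star_convergent I s x \<longrightarrow>
        rough_I_star_convergent I r (\<lambda>n. f (s n)) (f x))"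

end

theory Submission
  imports Defs
begin

text \<open>Ordinary convergence implies \<open>I\<^sup>*\<close>-convergence (take \<open>M = \<nat>\<close>), so testing rough
  \<open>I\<^sup>*\<close>-continuity on ordinary convergent sequences gives the \<open>\<epsilon>\<close>-\<open>\<delta>\<close> condition
  \<open>\<bar>f x - f x\<^sub>0\<bar> < r + \<epsilon>\<close> near \<open>x\<^sub>0\<close>. This condition does not mention the ideal, and it
  yields rough \<open>I\<close>-continuity with the same degree \<open>r\<close>.\<close>

lemma empty_in_ideal: "nontrivial_ideal I \<Longrightarrow> {} \<in> I"
  unfolding nontrivial_ideal_def set_ideal_def by blast

lemma LIMSEQ_imp_I_star_convergent:
  assumes "nontrivial_ideal I" and "s \<longlonglongrightarrow> x"
  shows "I_star_convergent I s x"
proof -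
  \<comment> \<open>The full index set is the complement of \<open>{}\<close>, and \<open>id\<close>
    enumerates it.\<close>
  have "range (id :: nat \<Rightarrow> nat) \<in> assoc_filter I"
    using empty_in_ideal[OF assms(1)] unfolding assoc_filter_def by force
  moreover have "\<forall>\<epsilon>>0. \<exists>N. \<forall>k\<ge>N. \<bar>s k - x\<bar> < \<epsilon>"
    using assms(2) by (simp add: LIMSEQ_iff)
  ultimately show ?thesis
    unfolding I_star_convergent_def rough_I_star_convergent_def
    by (intro exI[of _ id]) (simp add: strict_mono_def)
qed

lemma rough_epsilon_delta:
  assumes "nontrivial_ideal I" and "\<epsilon> > 0"
    and cont: "\<And>s. \<forall>n. s n \<in> D \<Longrightarrow> I_star_convergent I s x \<Longrightarrow>
      rough_I_star_convergent I r (\<lambda>n. f (s n)) (f x)"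
  shows "\<exists>\<delta>>0. \<forall>y\<in>D. \<bar>y - x\<bar> < \<delta> \<longrightarrow> \<bar>f y - f x\<bar> < r + \<epsilon>"
proof (rule ccontr)
  assume neg: "\<not> ?thesis"
  have "\<exists>y\<in>D. \<bar>y - x\<bar> < inverse (real (Suc n)) \<and> r + \<epsilon> \<le> \<bar>f y - f x\<bar>" for n
  proof -
    have "inverse (real (Suc n)) > 0" by simp
    with neg show ?thesis by (meson not_less)
  qed
  then obtain s where s: "\<And>n. s n \<in> D" "\<And>n. \<bar>s n - x\<bar> < inverse (real (Suc n))"
    and far: "\<And>n. r + \<epsilon> \<le> \<bar>f (s n) - f x\<bar>"
    by metis
  have "(\<lambda>n. s n - x) \<longlonglongrightarrow> 0"
    \<comment> \<open>The \<open>1\<close> is the constant factor in the comparison with the null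
      sequence \<open>inverse (Suc n)\<close>.\<close>
    by (rule tendsto_0_le[OF LIMSEQ_inverse_real_of_nat, of _ 1])
      (use s(2) in \<open>simp add: less_imp_le\<close>)
  then have "s \<longlonglongrightarrow> x"
    by (rule LIM_zero_cancel)
  then have "rough_I_star_convergent I r (\<lambda>n. f (s n)) (f x)"
    using assms(1) s(1) by (blast intro: cont LIMSEQ_imp_I_star_convergent)
  then obtain m :: "nat \<Rightarrow> nat" and N where "\<And>k. k \<ge> N \<Longrightarrow> \<bar>f (s (m k)) - f x\<bar> < r + \<epsilon>"
    unfolding rough_I_star_convergent_def using \<open>\<epsilon> > 0\<close> by blast
  \<comment> \<open>Since \<open>far\<close> holds at every index, the single index
    \<open>m N\<close> already gives the contradiction.\<close>
  with far show False
    by (meson le_refl not_less)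
qed

text \<open>By contraposition of \<open>ed\<close>, an index where \<open>f (s n)\<close> is far
  from \<open>f x\<close> is one where \<open>s n\<close> is at least \<delta> away from
  \<open>x\<close>. The set of such indices is in the ideal, which is closed under subsets.\<close>

lemma rough_I_convergent_compose:
  assumes "set_ideal I" and "\<forall>n. s n \<in> D" and "I_convergent I s x"
    and ed: "\<And>\<epsilon>. \<epsilon> > 0 \<Longrightarrow> \<exists>\<delta>>0. \<forall>y\<in>D. \<bar>y - x\<bar> < \<delta> \<longrightarrow> \<bar>f y - f x\<bar> < r + \<epsilon>"
  shows "rough_I_convergent I r (\<lambda>n. f (s n)) (f x)"
  unfolding rough_I_convergent_def
proof (intro allI impI)
  fix \<epsilon> :: real assume "\<epsilon> > 0"
  then obtain \<delta> where "\<delta> > 0" and \<delta>: "\<forall>y\<in>D. \<bar>y - x\<bar> < \<delta> \<longrightarrow> \<bar>f y - f x\<bar> < r + \<epsilon>"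
    using ed by blast
  have "{n. \<bar>s n - x\<bar> \<ge> \<delta>} \<in> I"
    using assms(3) \<open>\<delta> > 0\<close> unfolding I_convergent_def rough_I_convergent_def by simp
  moreover have "{n. \<bar>f (s n) - f x\<bar> \<ge> r + \<epsilon>} \<subseteq> {n. \<bar>s n - x\<bar> \<ge> \<delta>}"
    using \<delta> assms(2) by (force simp: not_less[symmetric])
  ultimately show "{n. \<bar>f (s n) - f x\<bar> \<ge> r + \<epsilon>} \<in> I"
    using assms(1) unfolding set_ideal_def by blast
qed

theorem theorem4p4:
  fixes I :: "nat set set" and D :: "real set" and f :: "real \<Rightarrow> real" and x\<^sub>0 :: real
  assumes "nontrivial_ideal I" and "admissible_ideal I"
    and "x\<^sub>0 \<in> D"
    and "rough_I_star_continuous_at I D f x\<^sub>0"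
  shows "rough_I_continuous_at I D f x\<^sub>0"
proof -
  obtain r where "r \<ge> 0" and cont: "\<And>s. \<forall>n. s n \<in> D \<Longrightarrow> I_star_convergent I s x\<^sub>0 \<Longrightarrow>
      rough_I_star_convergent I r (\<lambda>n. f (s n)) (f x\<^sub>0)"
    using assms(4) unfolding rough_I_star_continuous_at_def by blast
  have "set_ideal I"
    using assms(1) unfolding nontrivial_ideal_def by blast
  then have "rough_I_convergent I r (\<lambda>n. f (s n)) (f x\<^sub>0)"
    if "\<forall>n. s n \<in> D" "I_convergent I s x\<^sub>0" for s
    using that by (rule rough_I_convergent_compose) (rule rough_epsilon_delta[OF assms(1)], auto intro: cont)
  with \<open>r \<ge> 0\<close> show ?thesis
    unfolding rough_I_continuous_at_def by blast
qed

end
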